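(* Let $n$ be an even positive integer and let $\vec P_n$ be an alternating path on $n$ vertices. Then $\operatorname{th}(\vec P_n)=\frac n2+\left\lceil\sqrt{n+1}-1\right\rceil$.
   Context: An alternating path on $n$ vertices is an orientation of the path $P_n$ (each edge replaced by exactly one of its two arcs) in which every vertex is either a source (in-degree $0$) or a sink (out-degree $0$). Zero forcing on a digraph: vertices are blue or white; a blue vertex $u$ with exactly one white out-neighbor $w$ may force $w$ ($u\to w$), turning it blue. A set $\mathcal F$ of forces is a set of forces of $B\subseteq V$ if, starting with exactly $B$ blue, the forces in $\mathcal F$ can be validly performed in some order after which no further force is possible. Put $\mathcal F^{[0]}=B$ and $\mathcal F^{[t+1]}=\mathcal F^{[t]}\cup\{w\notin\mathcal F^{[t]}:(u\to w)\in\mathcal F,\ u\in\mathcal F^{[t]},\ w$ the only out-neighbor of $u$ outside $\mathcal F^{[t]}\}$; $\operatorname{pt}(\Gamma;\mathcal F)$ is the least $t$ with $\mathcal F^{[t]}=V$ ($\infty$ if none); $\operatorname{pt}(\Gamma;B)=\min_{\mathcal F}\operatorname{pt}(\Gamma;\mathcal F)$. The throttling number is $\operatorname{th}(\Gamma)=\min_{B\subseteq V}(|B|+\operatorname{pt}(\Gamma;B))$. *)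

theory Defs
  imports
    Complex_Main
    "HOL-Library.Extended_Nat"
    "Graph_Theory.Pair_Digraph"
begin

text \<open>
  Undirected graphs are given by their edge sets, consisting of two-element vertex sets.
  An arbitrary duplicate-free list \<open>vs\<close> of length \<open>n\<close> names the vertices of the path
  \<open>P\<^sub>n\<close> in order.
\<close>

definition path_edges :: "'a list \<Rightarrow> 'a set set" where
  "path_edges vs = {{vs ! i, vs ! Suc i} | i. Suc i < length vs}"

definition orientation_of :: "'a set \<Rightarrow> 'a set set \<Rightarrow> 'a pair_pre_digraph \<Rightarrow> bool" where
  "orientation_of V E D \<longleftrightarrow>
     pverts D = V \<and>
     (\<forall>u w. (u, w) \<in> parcs D \<longrightarrow> {u, w} \<in> E) \<and>
     (\<forall>u w. {u, w} \<in> E \<longrightarrow> ((u, w) \<in> parcs D) \<noteq> ((w, u) \<in> parcs D))"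

definition alternating_path :: "nat \<Rightarrow> 'a pair_pre_digraph \<Rightarrow> bool" where
  "alternating_path n D \<longleftrightarrow>
     (\<exists>vs. distinct vs \<and> length vs = n \<and> orientation_of (set vs) (path_edges vs) D) \<and>
     (\<forall>v \<in> pverts D. in_degree D v = 0 \<or> out_degree D v = 0)"

definition valid_force :: "'a pair_pre_digraph \<Rightarrow> 'a set \<Rightarrow> 'a \<Rightarrow> 'a \<Rightarrow> bool" where
  "valid_force D S u w \<longleftrightarrow> u \<in> S \<and> {x. (u, x) \<in> parcs D \<and> x \<notin> S} = {w}"

text \<open>A pair \<open>(u, w)\<close> stands for the force \<open>u \<rightarrow> w\<close>.\<close>

fun valid_force_seq :: "'a pair_pre_digraph \<Rightarrow> 'a set \<Rightarrow> ('a \<times> 'a) list \<Rightarrow> bool" where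
  "valid_force_seq D S [] \<longleftrightarrow> True"
| "valid_force_seq D S ((u, w) # fs) \<longleftrightarrow>
     valid_force D S u w \<and> valid_force_seq D (insert w S) fs"

definition set_of_forces :: "'a pair_pre_digraph \<Rightarrow> 'a set \<Rightarrow> ('a \<times> 'a) set \<Rightarrow> bool" where
  "set_of_forces D B F \<longleftrightarrow>
     (\<exists>fs. distinct fs \<and> set fs = F \<and> valid_force_seq D B fs) \<and>
     \<not> (\<exists>u w. valid_force D (B \<union> snd ` F) u w)"

fun stage :: "'a pair_pre_digraph \<Rightarrow> 'a set \<Rightarrow> ('a \<times> 'a) set \<Rightarrow> nat \<Rightarrow> 'a set" where
  "stage D B F 0 = B"
| "stage D B F (Suc t) =
     stage D B F t \<union>
     {w. w \<notin> stage D B F t \<and> (\<exists>u. (u, w) \<in> F \<and> valid_force D (stage D B F t) u w)}"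

text \<open>
  Infima in \<^typ>\<open>enat\<close> of nonempty sets are attained; the infimum of the empty set
  is \<open>\<infinity>\<close>.
\<close>

definition pt_forces :: "'a pair_pre_digraph \<Rightarrow> 'a set \<Rightarrow> ('a \<times> 'a) set \<Rightarrow> enat" where
  "pt_forces D B F = (INF t \<in> {t. stage D B F t = pverts D}. enat t)"

definition pt :: "'a pair_pre_digraph \<Rightarrow> 'a set \<Rightarrow> enat" where
  "pt D B = (INF F \<in> {F. set_of_forces D B F}. pt_forces D B F)"

definition throttling_number :: "'a pair_pre_digraph \<Rightarrow> enat" where
  "throttling_number D = (INF B \<in> Pow (pverts D). enat (card B) + pt D B)"

end

theory Submission
  imports Defs
begin

text \<open>
  With \<open>m = n div 2\<close>, label the sources \<open>a 1, \<dots>, a m\<close> and the sinks \<open>s 1, \<dots>, s m\<close> so that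
  the out-neighbours of \<open>a i\<close> are \<open>s i\<close> and, if \<open>i > 1\<close>, \<open>s (i - 1)\<close>. Every source must be
  blue from the start, and then blueness spreads along the sinks by one position per step in both
  directions; since \<open>a 1\<close> has a single out-neighbour, this behaves as if there were a further
  blue sink at position \<open>0\<close>. Hence \<open>k\<close> initially blue sinks can finish within \<open>t\<close> steps only if
  \<open>m \<le> t + k * (2 * t + 1)\<close>, that is \<open>n + 1 \<le> (2 * t + 1) * (2 * k + 1)\<close>, and spacing the blue
  sinks at distance \<open>2 * t + 1\<close> shows that this condition suffices. As \<open>n + 1\<close> is odd, it is
  solvable with \<open>t + k = r\<close> if and only if \<open>n + 1 \<le> (r + 1)\<^sup>2\<close>.
\<close>

section \<open>Realising the fastest propagation by a set of forces\<close>

lemma valid_force_mono: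
  assumes "valid_force D S u w" "S \<subseteq> T" "w \<notin> T"
  shows "valid_force D T u w"
  using assms unfolding valid_force_def by blast

lemma stage_step: "valid_force D (stage D B F t) u w \<Longrightarrow> (u, w) \<in> F \<Longrightarrow> w \<in> stage D B F (Suc t)"
  by (auto simp: valid_force_def)

lemma stage_Suc_cases:
  assumes "w \<in> stage D B F (Suc t)"
  obtains "w \<in> stage D B F t" | u where "(u, w) \<in> F" "valid_force D (stage D B F t) u w"
  using assms by auto

text \<open>With \<open>G = UNIV\<close> every valid force fires at once, which is the fastest
  propagation from \<open>B\<close>. A force firing for \<open>F\<close> also fires for
  \<open>G\<close> unless its target is already blue there.\<close>

lemma stage_mono_forces: "F \<subseteq> G \<Longrightarrow> stage D B F t \<subseteq> stage D B G t"
proof (induction t)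
  case (Suc t)
  show ?case
  proof
    fix w assume "w \<in> stage D B F (Suc t)"
    then show "w \<in> stage D B G (Suc t)"
    proof (cases rule: stage_Suc_cases)
      case 1
      with Suc show ?thesis by auto
    next
      case (2 u)
      show ?thesis
      proof (cases "w \<in> stage D B G t")
        case False
        with 2 Suc have "valid_force D (stage D B G t) u w" by (blast intro: valid_force_mono)
        then show ?thesis using 2 Suc.prems by (blast intro: stage_step)
      qed simp
    qed
  qed
qed simp

lemma stage_mono_time: "t \<le> t' \<Longrightarrow> stage D B F t \<subseteq> stage D B F t'"
  by (rule lift_Suc_mono_le) auto

lemma valid_force_seq_append:
  "valid_force_seq D S (fs @ gs) \<longleftrightarrow>
     valid_force_seq D S fs \<and> valid_force_seq D (S \<union> snd ` set fs) gs"
  by (induction fs arbitrary: S) auto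

text \<open>Each source has only its own target as white out-neighbour, so colouring one target
  leaves the other forces valid.\<close>

lemma valid_force_seq_simultaneous:
  assumes "distinct ws" "\<And>w. w \<in> set ws \<Longrightarrow> valid_force D S (u w) w"
  shows "valid_force_seq D S (map (\<lambda>w. (u w, w)) ws)"
  using assms
proof (induction ws arbitrary: S)
  case (Cons w ws)
  have "valid_force D (insert w S) (u x) x" if "x \<in> set ws" for x
    using Cons.prems that by (intro valid_force_mono[OF Cons.prems(2)]) (auto simp: valid_force_def)
  then show ?case using Cons by simp
qed simp

text \<open>\<open>UNIV\<close> need not be a set of forces: a vertex may be forced from two sides.
  One force is kept for each newly blue vertex, and the forces of each step are performed one after
  another; the last conjunct says that no time is lost.\<close>

lemma greedy_force_seq_exists:
  assumes "finite (stage D B UNIV t)"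
  shows "\<exists>fs. distinct fs \<and> valid_force_seq D B fs \<and> B \<union> snd ` set fs = stage D B UNIV t
           \<and> stage D B UNIV t \<subseteq> stage D B (set fs) t"
  using assms
proof (induction t)
  case 0
  show ?case by (intro exI[of _ "[]"]) auto
next
  case (Suc t)
  let ?G = "stage D B UNIV"
  from Suc obtain fs where fs: "distinct fs" "valid_force_seq D B fs"
    "B \<union> snd ` set fs = ?G t" "?G t \<subseteq> stage D B (set fs) t"
    by auto
  let ?N = "?G (Suc t) - ?G t"
  obtain ws where ws: "set ws = ?N" "distinct ws"
    using Suc.prems finite_distinct_list[of ?N] by blast
  have "\<exists>u. valid_force D (?G t) u w" if "w \<in> ?N" for w
    using that by auto
  then obtain u where u: "\<And>w. w \<in> ?N \<Longrightarrow> valid_force D (?G t) (u w) w"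
    by metis
  let ?gs = "map (\<lambda>w. (u w, w)) ws"
  \<comment> \<open>Monotonicity in the forces squeezes this stage between those of
    \<open>set fs\<close> and \<open>UNIV\<close>, which agree at time \<open>t\<close>.\<close>
  have stage_eq: "stage D B (set (fs @ ?gs)) t = ?G t"
    using fs(4) stage_mono_forces[of "set fs" "set (fs @ ?gs)" D B t]
      stage_mono_forces[of "set (fs @ ?gs)" UNIV D B t] by auto
  have "snd ` set ?gs = ?N" using ws by force
  moreover have "?G t \<subseteq> ?G (Suc t)" by auto
  ultimately have "B \<union> snd ` set (fs @ ?gs) = ?G (Suc t)"
    unfolding set_append image_Un using fs(3) by blast
  moreover have "distinct (fs @ ?gs)"
  proof -
    have "x \<notin> set ws" if "(y, x) \<in> set fs" for x y
      using that fs(3) ws(1) by force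
    then show ?thesis using fs(1) ws(2) by (auto simp: distinct_map inj_on_def)
  qed
  moreover have "valid_force_seq D B (fs @ ?gs)"
    unfolding valid_force_seq_append fs(3)
    using fs(2) ws u by (blast intro: valid_force_seq_simultaneous)
  moreover have "?G (Suc t) \<subseteq> stage D B (set (fs @ ?gs)) (Suc t)"
  proof
    fix w assume w: "w \<in> ?G (Suc t)"
    show "w \<in> stage D B (set (fs @ ?gs)) (Suc t)"
    proof (cases "w \<in> ?G t")
      case True
      then show ?thesis using stage_eq by simp
    next
      case False
      then have "valid_force D (stage D B (set (fs @ ?gs)) t) (u w) w"
        unfolding stage_eq using u w by blast
      then show ?thesis using False w ws(1) by (intro stage_step) auto
    qed
  qed
  ultimately show ?case by blast
qed

lemma pt_le:
  assumes "finite (pverts D)" "\<And>u w. (u, w) \<in> parcs D \<Longrightarrow> w \<in> pverts D"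
    and V: "stage D B UNIV t = pverts D"
  shows "pt D B \<le> enat t"
proof -
  obtain fs where fs: "distinct fs" "valid_force_seq D B fs" "B \<union> snd ` set fs = pverts D"
    "pverts D \<subseteq> stage D B (set fs) t"
    using greedy_force_seq_exists[of D B t] assms(1) V by auto
  have "set_of_forces D B (set fs)"
    unfolding set_of_forces_def fs(3) using fs assms(2) unfolding valid_force_def by blast
  moreover have "stage D B (set fs) t = pverts D"
    using fs(4) V stage_mono_forces[of "set fs" UNIV D B t] by blast
  ultimately show ?thesis
    unfolding pt_def pt_forces_def by (auto intro!: INF_lower2)
qed

text \<open>The stages for \<open>UNIV\<close> dominate those of every \<open>F\<close>, so a time
  bound for them holds for all sets of forces.\<close>

lemma pt_ge:
  assumes "\<And>t. stage D B UNIV t \<supseteq> pverts D \<Longrightarrow> N \<le> t"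
  shows "enat N \<le> pt D B"
  unfolding pt_def pt_forces_def
proof (intro INF_greatest)
  fix F t assume "t \<in> {t. stage D B F t = pverts D}"
  then have "pverts D \<subseteq> stage D B UNIV t"
    using stage_mono_forces[of F UNIV D B t] by auto
  then show "enat N \<le> enat t" using assms by simp
qed

section \<open>Propagation on an alternating path\<close>

text \<open>The order along the path is \<open>a 1, s 1, a 2, s 2, ..., a m, s m\<close>. Counting
  from 1 keeps position 0 free for the fictitious blue sink.\<close>

locale alternating_labelling =
  fixes D :: "'a pair_pre_digraph" and m :: nat and a s :: "nat \<Rightarrow> 'a"
  assumes inj_a: "inj_on a {1..m}" and inj_s: "inj_on s {1..m}"
    and disj: "a ` {1..m} \<inter> s ` {1..m} = {}"
    and verts: "pverts D = a ` {1..m} \<union> s ` {1..m}"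
    and arcs: "parcs D = {(a i, s j) | i j. i \<in> {1..m} \<and> j \<in> {1..m} \<and> (j = i \<or> Suc j = i)}"
begin

lemma out_neighbour_iff:
  assumes "i \<in> {1..m}"
  shows "(a i, x) \<in> parcs D \<longleftrightarrow> (\<exists>j\<in>{1..m}. x = s j \<and> (j = i \<or> Suc j = i))"
proof -
  have "a i = a i' \<longleftrightarrow> i = i'" if "i' \<in> {1..m}" for i'
    using inj_a assms that by (rule inj_on_eq_iff)
  then show ?thesis using assms unfolding arcs by blast
qed

lemma s_eq_iff: "i \<in> {1..m} \<Longrightarrow> j \<in> {1..m} \<Longrightarrow> s i = s j \<longleftrightarrow> i = j"
  using inj_s by (auto dest: inj_onD)

text \<open>No arc ends in a source, so a source can never be forced.\<close>

lemma source_in_stage_imp: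
  assumes "i \<in> {1..m}" "a i \<in> stage D B F t"
  shows "a i \<in> B"
  using assms(2)
proof (induction t)
  case (Suc t)
  from Suc.prems show ?case
  proof (cases rule: stage_Suc_cases)
    case (2 u)
    then have "(u, a i) \<in> parcs D" by (auto simp: valid_force_def)
    then show ?thesis using disj assms(1) unfolding arcs by blast
  qed (use Suc in auto)
qed simp

lemma sink_in_stage_near:
  assumes "j \<in> {1..m}" "s j \<in> stage D B F t"
  shows "\<exists>c \<in> insert 0 {c \<in> {1..m}. s c \<in> B}. j \<le> c + t \<and> c \<le> j + t"
  using assms
proof (induction t arbitrary: j)
  case (Suc t)
  let ?C = "insert 0 {c \<in> {1..m}. s c \<in> B}" and ?S = "stage D B F t"
  from Suc.prems(2) show ?case
  proof (cases rule: stage_Suc_cases)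
    case 1
    then obtain c where "c \<in> ?C" "j \<le> c + t" "c \<le> j + t" using Suc by blast
    then show ?thesis by (intro bexI[of _ c]) auto
  next
    case (2 u)
    then have f: "(u, s j) \<in> parcs D" "\<And>x. (u, x) \<in> parcs D \<Longrightarrow> x \<noteq> s j \<Longrightarrow> x \<in> ?S"
      by (auto simp: valid_force_def)
    then obtain i where i: "u = a i" "i \<in> {1..m}" "j = i \<or> Suc j = i"
      unfolding arcs using s_eq_iff Suc.prems(1) by blast
    \<comment> \<open>The position of the other out-neighbour of \<open>a i\<close>, already blue at
      time \<open>t\<close>; it is 0 exactly when \<open>a 1\<close> forces
      \<open>s 1\<close>.\<close>
    define j' where "j' = (if j = i then j - 1 else Suc j)"
    show ?thesis
    proof (cases "j' = 0")
      case True
      then have "j = 1" using Suc.prems(1) by (auto simp: j'_def split: if_splits)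
      then show ?thesis by (intro bexI[of _ 0]) auto
    next
      case False
      then have j': "j' \<in> {1..m}" "j' \<noteq> j" "j' = i \<or> Suc j' = i" "j \<le> Suc j'" "j' \<le> Suc j"
        using i Suc.prems(1) by (auto simp: j'_def split: if_splits)
      then have "(u, s j') \<in> parcs D" "s j' \<noteq> s j"
        using i Suc.prems(1) by (auto simp: out_neighbour_iff s_eq_iff)
      then have "s j' \<in> ?S" by (rule f(2))
      then obtain c where "c \<in> ?C" "j' \<le> c + t" "c \<le> j' + t" using Suc.IH j'(1) by blast
      then show ?thesis using j' by (intro bexI[of _ c]) auto
    qed
  qed
qed auto

lemma sink_near_in_stage:
  assumes a: "a ` {1..m} \<subseteq> B" and C: "C \<subseteq> {1..m}" "s ` C \<subseteq> B"
    and "j \<in> {1..m}" "c \<in> insert 0 C" "j \<le> c + t" "c \<le> j + t"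
  shows "s j \<in> stage D B UNIV t"
  using assms(4-)
proof (induction t arbitrary: j)
  case 0
  then show ?case using C by auto
next
  case (Suc t)
  let ?S = "stage D B UNIV t"
  \<comment> \<open>A sink is forced from the side facing the blue centre \<open>c\<close>: by
    \<open>a j\<close> if \<open>c\<close> lies to the left, by \<open>a (Suc j)\<close> if to the
    right. For \<open>j = 1\<close>, \<open>a j\<close> has no other out-neighbour, so
    \<open>S\<close> is vacuous.\<close>
  have force: "s j \<in> stage D B UNIV (Suc t)"
    if i: "i \<in> {1..m}" "j = i \<or> Suc j = i"
      and S: "\<And>j'. j' \<in> {1..m} \<Longrightarrow> j' = i \<or> Suc j' = i \<Longrightarrow> j' \<noteq> j \<Longrightarrow> s j' \<in> ?S" for i
  proof (cases "s j \<in> ?S")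
    case False
    have "a i \<in> ?S" using a i(1) stage_mono_time[of 0 t D B UNIV] by (auto simp del: atLeastAtMost_iff)
    moreover have "{x. (a i, x) \<in> parcs D \<and> x \<notin> ?S} = {s j}"
      using i S False Suc.prems(1) by (auto simp: out_neighbour_iff)
    ultimately have "valid_force D ?S (a i) (s j)" by (simp add: valid_force_def)
    then show ?thesis by (rule stage_step) simp
  qed simp
  consider "j \<le> c + t" "c \<le> j + t" | "j = Suc (c + t)" | "c = Suc (j + t)"
    using Suc.prems by linarith
  then show ?case
  proof cases
    case 1
    then show ?thesis using Suc by auto
  next
    case 2
    show ?thesis
    proof (rule force[of j])
      fix j' assume "j' \<in> {1..m}" "j' = j \<or> Suc j' = j" "j' \<noteq> j"
      then show "s j' \<in> ?S" using Suc.prems 2 by (intro Suc.IH) auto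
    qed (use Suc.prems in auto)
  next
    case 3
    then have "Suc j \<in> {1..m}" using Suc.prems C by auto
    then show ?thesis
    proof (rule force[of "Suc j"])
      fix j' assume "j' \<in> {1..m}" "j' = Suc j \<or> Suc j' = Suc j" "j' \<noteq> j"
      then show "s j' \<in> ?S" using Suc.prems 3 by (intro Suc.IH) auto
    qed simp
  qed
qed

lemma finite_verts: "finite (pverts D)"
  by (simp add: verts)

text \<open>Here \<open>k\<close> counts the initially blue sinks. Each covers at most
  \<open>2 * t + 1\<close> positions within \<open>t\<close> steps, the fictitious sink at 0 only
  \<open>t\<close>.\<close>

lemma blue_sinks_bound:
  assumes "B \<subseteq> pverts D" "pverts D \<subseteq> stage D B UNIV t"
  obtains k where "card B = m + k" "m \<le> t + k * (2 * t + 1)"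
proof -
  define C where "C = {c \<in> {1..m}. s c \<in> B}"
  have "a ` {1..m} \<subseteq> B"
    using assms(2) source_in_stage_imp unfolding verts by blast
  then have B: "B = a ` {1..m} \<union> s ` C" and "C \<subseteq> {1..m}"
    using assms(1) unfolding C_def verts by blast+
  then have "card B = card (a ` {1..m}) + card (s ` C)"
    using disj finite_subset[of C "{1..m}"] by (subst B, intro card_Un_disjoint) auto
  also have "\<dots> = m + card C"
    using inj_a inj_on_subset[OF inj_s \<open>C \<subseteq> {1..m}\<close>] by (simp add: card_image)
  finally have "card B = m + card C" .
  moreover have "m \<le> t + card C * (2 * t + 1)"
  proof -
    have "{1..m} \<subseteq> {1..t} \<union> (\<Union>c\<in>C. {c - t..c + t})"
    proof
      fix j assume j: "j \<in> {1..m}"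
      then have "s j \<in> stage D B UNIV t" using assms(2) unfolding verts by blast
      from sink_in_stage_near[OF j this] obtain c
        where "c \<in> insert 0 C" "j \<le> c + t" "c \<le> j + t"
        unfolding C_def by blast
      then show "j \<in> {1..t} \<union> (\<Union>c\<in>C. {c - t..c + t})" using j by auto
    qed
    then have "card {1..m} \<le> card ({1..t} \<union> (\<Union>c\<in>C. {c - t..c + t}))"
      by (intro card_mono) (auto simp: C_def)
    also have "\<dots> \<le> card {1..t} + card (\<Union>c\<in>C. {c - t..c + t})" by (rule card_Un_le)
    also have "card (\<Union>c\<in>C. {c - t..c + t}) \<le> (\<Sum>c\<in>C. card {c - t..c + t})"
      by (rule card_UN_le) (simp add: C_def)
    \<comment> \<open>Truncation in \<open>c - t\<close> can only shrink an interval.\<close>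
    also have "\<dots> \<le> card C * (2 * t + 1)"
      using sum_bounded_above[of C "\<lambda>c. card {c - t..c + t}" "2 * t + 1"] by simp
    finally show ?thesis by simp
  qed
  ultimately show ?thesis using that by blast
qed

text \<open>The cardinality is only bounded from above because truncation may merge several centres
  at \<open>m\<close>.\<close>

lemma blue_set_exists:
  assumes "m > 0" "m \<le> t + k * (2 * t + 1)"
  obtains B where "B \<subseteq> pverts D" "card B \<le> m + k" "stage D B UNIV t = pverts D"
proof -
  let ?d = "2 * t + 1"
  \<comment> \<open>The last interval may stick out beyond \<open>m\<close>, hence the truncation.\<close>
  define C where "C = (\<lambda>i. min (?d * i) m) ` {1..k}"
  define B where "B = a ` {1..m} \<union> s ` C"
  have C: "C \<subseteq> {1..m}" using assms(1) by (auto simp: C_def)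
  have "card B \<le> card (a ` {1..m}) + card (s ` C)" unfolding B_def by (rule card_Un_le)
  also have "card (a ` {1..m}) \<le> m" using card_image_le[of "{1..m}" a] by simp
  also have "card (s ` C) \<le> card C" by (rule card_image_le) (simp add: C_def)
  also have "card C \<le> k" unfolding C_def using card_image_le[of "{1..k}"] by fastforce
  finally have card: "card B \<le> m + k" by simp
  have sub: "B \<subseteq> pverts D" using C by (auto simp: B_def verts)
  have "s j \<in> stage D B UNIV t" if j: "j \<in> {1..m}" for j
  proof -
    \<comment> \<open>Adding \<open>t\<close> before dividing rounds to the nearest multiple of
      \<open>?d\<close>, which is thus within \<open>t\<close> of \<open>j\<close>. For
      \<open>i = 0\<close> it is the fictitious sink.\<close>
    define i where "i = (j + t) div ?d"
    have "j + t = ?d * i + (j + t) mod ?d" unfolding i_def by (rule mult_div_mod_eq[symmetric])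
    moreover have "(j + t) mod ?d < ?d" by simp
    ultimately have i: "?d * i \<le> j + t" "j + t < ?d * i + ?d" by linarith+
    have "?d * i < ?d * Suc k" using i(1) assms(2) j by (simp add: algebra_simps)
    then have "i \<le> k" by (simp only: mult_less_cancel1 less_Suc_eq_le)
    then have "min (?d * i) m \<in> insert 0 C" by (cases "i = 0") (auto simp: C_def)
    then show ?thesis
      using i j C by (intro sink_near_in_stage[of B C j "min (?d * i) m"]) (auto simp: B_def)
  qed
  moreover have "a ` {1..m} \<subseteq> stage D B UNIV t"
    using stage_mono_time[of 0 t D B UNIV] by (auto simp: B_def)
  ultimately have "pverts D \<subseteq> stage D B UNIV t" by (auto simp: verts)
  moreover have "stage D B UNIV t \<subseteq> pverts D"
  proof (induction t)
    case 0
    show ?case using sub by simp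
  next
    case (Suc t)
    have "w \<in> pverts D" if "valid_force D S u w" for S u w
    proof -
      have "(u, w) \<in> parcs D" using that by (auto simp: valid_force_def)
      then show ?thesis unfolding arcs verts by blast
    qed
    with Suc show ?case by auto
  qed
  ultimately show ?thesis using that sub card by blast
qed

text \<open>The \<open>m\<close> sources are a fixed cost, so what remains is to minimise
  \<open>t + k\<close> under the covering inequality.\<close>

lemma throttling_number_eqI:
  assumes "m > 0"
    and lower: "\<And>t k. m \<le> t + k * (2 * t + 1) \<Longrightarrow> r \<le> t + k"
    and upper: "m \<le> t + k * (2 * t + 1)" "t + k = r"
  shows "throttling_number D = enat (m + r)"
proof (rule antisym)
  obtain B where B: "B \<subseteq> pverts D" "card B \<le> m + k" "stage D B UNIV t = pverts D"
    using blue_set_exists assms(1) upper(1) by blast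
  have "enat (card B) + pt D B \<le> enat (m + k) + enat t"
    using B by (intro add_mono pt_le) (auto simp: finite_verts verts arcs)
  then show "throttling_number D \<le> enat (m + r)"
    unfolding throttling_number_def using B(1) upper(2)
    by (intro INF_lower2[of B]) (auto simp: add_ac)
next
  show "enat (m + r) \<le> throttling_number D"
    unfolding throttling_number_def
  proof (rule INF_greatest)
    fix B assume "B \<in> Pow (pverts D)"
    then have B: "B \<subseteq> pverts D" by simp
    \<comment> \<open>If \<open>card B\<close> exceeds \<open>m + r\<close>, the truncated
      difference is 0, and \<open>card B\<close> alone meets the bound.\<close>
    have "m + r - card B \<le> t" if V: "pverts D \<subseteq> stage D B UNIV t" for t
    proof -
      obtain k where "card B = m + k" "m \<le> t + k * (2 * t + 1)"
        using B V by (rule blue_sinks_bound)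
      then show ?thesis using lower[of t k] by linarith
    qed
    then have "enat (m + r - card B) \<le> pt D B" by (rule pt_ge)
    then have "enat (card B) + enat (m + r - card B) \<le> enat (card B) + pt D B"
      by (rule add_left_mono)
    then show "enat (m + r) \<le> enat (card B) + pt D B"
      by (rule order_trans[rotated]) simp
  qed
qed

end

section \<open>Labelling an alternating path\<close>

text \<open>Allows the path to be read from the end that is a source.\<close>

lemma orientation_of_path_rev:
  "orientation_of (set (rev vs)) (path_edges (rev vs)) D = orientation_of (set vs) (path_edges vs) D"
proof -
  have "path_edges xs \<subseteq> path_edges (rev xs)" for xs :: "'a list"
  proof
    fix e assume "e \<in> path_edges xs"
    then obtain i where "e = {xs ! i, xs ! Suc i}" "Suc i < length xs"
      by (auto simp: path_edges_def)
    then have "e = {rev xs ! (length xs - 2 - i), rev xs ! Suc (length xs - 2 - i)}"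
      "Suc (length xs - 2 - i) < length xs"
      by (auto simp: rev_nth Suc_diff_Suc numeral_2_eq_2 insert_commute)
    then show "e \<in> path_edges (rev xs)" unfolding path_edges_def by force
  qed
  from this[of vs] this[of "rev vs"] show ?thesis by simp
qed

text \<open>Arc directions alternate along the path. As \<open>n\<close> is even, exactly one end is
  a source; started there, the sources occupy the even positions.\<close>

lemma alternating_path_arcs:
  assumes "even n" "n > 0" "alternating_path n D"
  obtains vs where "distinct vs" "length vs = n" "pverts D = set vs"
    "\<And>x y. (x, y) \<in> parcs D \<longleftrightarrow>
       (\<exists>i j. i < n \<and> j < n \<and> even i \<and> (j = Suc i \<or> i = Suc j) \<and> x = vs ! i \<and> y = vs ! j)"
proof -
  have no_through: "(u, v) \<notin> parcs D \<or> (v, w) \<notin> parcs D"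
    if "orientation_of (set vs) (path_edges vs) D" for vs u v w
  proof -
    have sub: "parcs D \<subseteq> set vs \<times> set vs"
      using that unfolding orientation_of_def path_edges_def
      by (fastforce simp: doubleton_eq_iff)
    \<comment> \<open>Degrees are cardinalities, so degree 0 excludes arcs only when the arc set is
      finite.\<close>
    have fin: "finite (parcs D)" by (rule finite_subset[OF sub]) simp
    show ?thesis
    proof (rule ccontr)
      assume *: "\<not> ?thesis"
      then have "v \<in> pverts D" using sub that unfolding orientation_of_def by auto
      then consider "in_degree D v = 0" | "out_degree D v = 0"
        using assms(3)[unfolded alternating_path_def, THEN conjunct2] by metis
      then show False
        using * fin by cases (auto simp: in_degree_def out_degree_def in_arcs_def out_arcs_def)
    qed
  qed
  obtain ws where ws: "distinct ws" "length ws = n" "orientation_of (set ws) (path_edges ws) D"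
    using assms(3) unfolding alternating_path_def by blast
  have "\<exists>vs. distinct vs \<and> length vs = n \<and> orientation_of (set vs) (path_edges vs) D
          \<and> (vs ! 0, vs ! 1) \<in> parcs D"
  proof (cases "(ws ! 0, ws ! 1) \<in> parcs D")
    case False
    have edge: "((ws ! i, ws ! Suc i) \<in> parcs D) \<noteq> ((ws ! Suc i, ws ! i) \<in> parcs D)"
      if "Suc i < n" for i
      using ws that unfolding orientation_of_def path_edges_def by blast
    have "Suc i < n \<Longrightarrow> ((ws ! i, ws ! Suc i) \<in> parcs D) = odd i" for i
    proof (induction i)
      case (Suc i)
      then show ?case
        using edge[of i] edge[of "Suc i"] no_through[OF ws(3)] by (metis Suc_lessD even_Suc)
    qed (use False in simp)
    \<comment> \<open>The last edge has the even index \<open>n - 2\<close>, so it points backwards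
      and becomes a forward first arc after reversal.\<close>
    moreover have "Suc (n - 2) < n" "even (n - 2)" using assms(1,2) by auto
    ultimately have "(ws ! Suc (n - 2), ws ! (n - 2)) \<in> parcs D" using edge by blast
    then have "(rev ws ! 0, rev ws ! 1) \<in> parcs D"
      using ws \<open>Suc (n - 2) < n\<close> by (simp add: rev_nth numeral_2_eq_2 Suc_diff_Suc)
    then show ?thesis
      using ws orientation_of_path_rev[of ws D] by (intro exI[of _ "rev ws"]) simp
  qed (use ws in auto)
  then obtain vs where vs: "distinct vs" "length vs = n"
    "orientation_of (set vs) (path_edges vs) D" "(vs ! 0, vs ! 1) \<in> parcs D"
    by blast
  have edge: "((vs ! i, vs ! Suc i) \<in> parcs D) \<noteq> ((vs ! Suc i, vs ! i) \<in> parcs D)"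
    if "Suc i < n" for i
    using vs that unfolding orientation_of_def path_edges_def by blast
  have fwd: "Suc i < n \<Longrightarrow> ((vs ! i, vs ! Suc i) \<in> parcs D) = even i" for i
  proof (induction i)
    case (Suc i)
    then show ?case
      using edge[of i] edge[of "Suc i"] no_through[OF vs(3)] by (metis Suc_lessD even_Suc)
  qed (use vs in simp)
  have bwd: "Suc i < n \<Longrightarrow> ((vs ! Suc i, vs ! i) \<in> parcs D) = odd i" for i
    using edge fwd by blast
  have "(x, y) \<in> parcs D \<longleftrightarrow>
       (\<exists>i j. i < n \<and> j < n \<and> even i \<and> (j = Suc i \<or> i = Suc j) \<and> x = vs ! i \<and> y = vs ! j)"
    (is "?L \<longleftrightarrow> ?R") for x y
  proof
    assume L: ?L
    then have "{x, y} \<in> path_edges vs" using vs(3) unfolding orientation_of_def by blast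
    then obtain i where i: "Suc i < n" and "{x, y} = {vs ! i, vs ! Suc i}"
      using vs(2) unfolding path_edges_def by blast
    then consider "x = vs ! i" "y = vs ! Suc i" | "x = vs ! Suc i" "y = vs ! i"
      by (auto simp: doubleton_eq_iff)
    then show ?R
    proof cases
      case 1
      then show ?thesis using L i fwd[of i] by (intro exI[of _ i] exI[of _ "Suc i"]) auto
    next
      case 2
      then show ?thesis using L i bwd[of i] by (intro exI[of _ "Suc i"] exI[of _ i]) auto
    qed
  next
    assume ?R
    then show ?L using fwd bwd by auto
  qed
  moreover have "pverts D = set vs" using vs(3) unfolding orientation_of_def by blast
  ultimately show ?thesis using that vs by blast
qed

lemma alternating_path_labelling:
  assumes "alternating_path (2 * m) D" "m > 0"
  obtains a s where "alternating_labelling D m a s"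
proof -
  obtain vs where vs: "distinct vs" "length vs = 2 * m" "pverts D = set vs"
    and arcs: "\<And>x y. (x, y) \<in> parcs D \<longleftrightarrow> (\<exists>i j. i < 2 * m \<and> j < 2 * m \<and> even i
       \<and> (j = Suc i \<or> i = Suc j) \<and> x = vs ! i \<and> y = vs ! j)"
    using alternating_path_arcs[of "2 * m" D] assms by auto
  define a where "a i = vs ! (2 * i - 2)" for i
  define s where "s i = vs ! (2 * i - 1)" for i
  have inj: "vs ! i = vs ! j \<longleftrightarrow> i = j" if "i < 2 * m" "j < 2 * m" for i j
    using vs that by (simp add: nth_eq_iff_index_eq)
  have "alternating_labelling D m a s"
  proof
    show "inj_on a {1..m}" by (rule inj_onI) (auto simp: a_def inj)
    show "inj_on s {1..m}" by (rule inj_onI) (auto simp: s_def inj)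
    show "a ` {1..m} \<inter> s ` {1..m} = {}"
    proof -
      have "a i \<noteq> s j" if "i \<in> {1..m}" "j \<in> {1..m}" for i j
      proof -
        have "2 * i - 2 \<noteq> 2 * j - 1" using that by simp presburger
        then show ?thesis using that by (auto simp: a_def s_def inj)
      qed
      then show ?thesis by blast
    qed
    show "pverts D = a ` {1..m} \<union> s ` {1..m}"
    proof -
      have "vs ! i \<in> a ` {1..m} \<union> s ` {1..m}" if "i < 2 * m" for i
      proof (cases "even i")
        case True
        then obtain q where "i = 2 * q" by blast
        then show ?thesis using that by (intro UnI1 image_eqI[of _ _ "Suc q"]) (auto simp: a_def)
      next
        case False
        then obtain q where "i = 2 * q + 1" by (blast elim: oddE)
        then show ?thesis using that by (intro UnI2 image_eqI[of _ _ "Suc q"]) (auto simp: s_def)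
      qed
      moreover have "a i \<in> set vs" "s i \<in> set vs" if "i \<in> {1..m}" for i
        using that vs(2) by (auto simp: a_def s_def)
      ultimately show ?thesis unfolding vs(3) using vs(2)
        by (intro equalityI subsetI) (metis in_set_conv_nth, blast)
    qed
    have "(x, y) \<in> parcs D \<longleftrightarrow>
        (\<exists>i j. x = a i \<and> y = s j \<and> i \<in> {1..m} \<and> j \<in> {1..m} \<and> (j = i \<or> Suc j = i))"
      (is "?L \<longleftrightarrow> ?R") for x y
    proof
      assume ?L
      then obtain i j where ij: "i < 2 * m" "j < 2 * m" "even i" "j = Suc i \<or> i = Suc j"
        "x = vs ! i" "y = vs ! j"
        unfolding arcs by blast
      from \<open>even i\<close> obtain q where q: "i = 2 * q" by blast
      from ij(4) show ?R
      proof
        assume "j = Suc i"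
        then show ?thesis using ij q
          by (intro exI[of _ "Suc q"] exI[of _ "Suc q"]) (auto simp: a_def s_def)
      next
        assume "i = Suc j"
        then have "j = 2 * q - 1" "q > 0" using q by auto
        then show ?thesis using ij q
          by (intro exI[of _ "Suc q"] exI[of _ q]) (auto simp: a_def s_def)
      qed
    next
      assume ?R
      then obtain i j where ij: "x = a i" "y = s j" "i \<in> {1..m}" "j \<in> {1..m}" "j = i \<or> Suc j = i"
        by blast
      then show ?L unfolding arcs
        by (intro exI[of _ "2 * i - 2"] exI[of _ "2 * j - 1"]) (auto simp: a_def s_def)
    qed
    then show "parcs D = {(a i, s j) | i j. i \<in> {1..m} \<and> j \<in> {1..m} \<and> (j = i \<or> Suc j = i)}"
      by auto
  qed
  then show ?thesis using that by blast
qed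

section \<open>The optimal number of blue sinks\<close>

lemma nat_ceiling_sqrt_minus_1_le_iff:
  "nat \<lceil>sqrt (real n + 1) - 1\<rceil> \<le> x \<longleftrightarrow> n + 1 \<le> (x + 1)\<^sup>2"
proof -
  have "nat \<lceil>sqrt (real n + 1) - 1\<rceil> \<le> x \<longleftrightarrow> sqrt (real n + 1) \<le> real x + 1"
    by (simp add: nat_le_iff ceiling_le_iff algebra_simps)
  also have "\<dots> \<longleftrightarrow> real n + 1 \<le> (real x + 1)\<^sup>2"
    by (metis abs_of_nonneg add_nonneg_nonneg of_nat_0_le_iff real_sqrt_abs real_sqrt_le_iff zero_le_one)
  also have "\<dots> \<longleftrightarrow> real (n + 1) \<le> real ((x + 1)\<^sup>2)" by (simp add: add_ac)
  finally show ?thesis by (simp only: of_nat_le_iff)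
qed

text \<open>The hypothesis amounts to \<open>2 * m + 1 \<le> (2 * t + 1) * (2 * k + 1)\<close>, and
  this product is \<open>(t + k + 1)\<^sup>2 - (t - k)\<^sup>2\<close>. Integers make the difference
  genuine.\<close>

lemma covering_imp_square_bound:
  fixes m t k :: nat
  assumes "m \<le> t + k * (2 * t + 1)"
  shows "2 * m + 1 \<le> (t + k + 1)\<^sup>2"
proof -
  have "int (2 * m + 1) \<le> (2 * int t + 1) * (2 * int k + 1)"
  proof -
    have "2 * m + 1 \<le> (2 * t + 1) * (2 * k + 1)" using assms by (simp add: algebra_simps)
    then have "int (2 * m + 1) \<le> int ((2 * t + 1) * (2 * k + 1))" by (simp only: of_nat_le_iff)
    also have "\<dots> = (2 * int t + 1) * (2 * int k + 1)" by (simp add: algebra_simps)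
    finally show ?thesis .
  qed
  also have "\<dots> = (int t + int k + 1)\<^sup>2 - (int t - int k)\<^sup>2"
    by (simp add: power2_eq_square algebra_simps)
  also have "\<dots> \<le> int ((t + k + 1)\<^sup>2)" by (simp add: add_ac)
  finally show ?thesis by (simp only: of_nat_le_iff)
qed

text \<open>Take \<open>t\<close> and \<open>k\<close> as equal as possible. For odd
  \<open>r\<close> the product falls short of \<open>(r + 1)\<^sup>2\<close> by 1, which is
  harmless: that square is even and \<open>2 * m + 1\<close> is odd.\<close>

lemma square_bound_imp_covering:
  fixes m r :: nat
  assumes "2 * m + 1 \<le> (r + 1)\<^sup>2"
  obtains t k where "m \<le> t + k * (2 * t + 1)" "t + k = r"
proof (cases "even r")
  case True
  then obtain q where "r = 2 * q" by blast
  then show ?thesis using assms that[of q q] by (simp add: power2_eq_square algebra_simps)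
next
  case False
  then obtain q where "r = 2 * q + 1" by (blast elim: oddE)
  then show ?thesis using assms that[of q "Suc q"] by (simp add: power2_eq_square algebra_simps)
qed

theorem theorem4p9:
  fixes n :: nat and P :: "'a pair_pre_digraph"
  assumes "even n" and "n > 0" and "alternating_path n P"
  shows "throttling_number P = enat (n div 2 + nat \<lceil>sqrt (real n + 1) - 1\<rceil>)"
proof -
  define r where "r = nat \<lceil>sqrt (real n + 1) - 1\<rceil>"
  obtain m where n: "n = 2 * m" using assms(1) by blast
  with assms obtain a s where "alternating_labelling P m a s"
    using alternating_path_labelling[of m P] by auto
  then interpret alternating_labelling P m a s .
  \<comment> \<open>Used with \<open>x = r\<close> to obtain an optimal pair \<open>t\<close>,
    \<open>k\<close>, and with \<open>x = t + k\<close> for the lower bound.\<close>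
  have r_le_iff: "r \<le> x \<longleftrightarrow> 2 * m + 1 \<le> (x + 1)\<^sup>2" for x
    unfolding r_def nat_ceiling_sqrt_minus_1_le_iff n by simp
  then obtain t k where tk: "m \<le> t + k * (2 * t + 1)" "t + k = r"
    using square_bound_imp_covering by blast
  have "throttling_number P = enat (m + r)"
    using assms(2) n tk covering_imp_square_bound by (intro throttling_number_eqI) (auto simp: r_le_iff)
  then show ?thesis by (simp add: n r_def)
qed

end
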